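(* Let $p$ be a prime and let $q=2n$ be an even divisor of $p-1$ such that $-1\notin H$, i.e. $p\equiv q+1\pmod{2q}$, where $H$ is the subgroup of index $q$ of $G=(\mathbb{Z}/p\mathbb{Z})^{\times}$. Let $b\ge 2$ be a natural number with $p\nmid b$. For the $b$-deviation vector $T^{(b)}$ of $G/H$ and each odd character $\chi\in X^-$, $$\langle T^{(b)},\chi\rangle=\frac{(b-\chi(b))\,B_{\overline{\chi}}}{2},$$ where $\overline{\chi}$ denotes the complex conjugate character of $\chi$.
   Context: $G=(\mathbb{Z}/p\mathbb{Z})^{\times}$, and $H=\{x^q : x\in G\}$ is its unique subgroup of index $q$. Each class $C\in G/H$ is identified with the set of integers $k\in\{1,\ldots,p-1\}$ whose residue class mod $p$ lies in $C$. For an integer $k$, $(k)_p$ denotes the number $j\in\{0,\ldots,p-1\}$ with $j\equiv k\pmod p$, and $\theta_b(k)=\bigl(b(k)_p-(bk)_p\bigr)/p$. For $C\in G/H$ put $S^{(b)}_C=\sum_{k\in C}\theta_b(k)$ and $T^{(b)}_C=S^{(b)}_C-E^{(b)}$ with $E^{(b)}=\frac{(b-1)(p-1)}{2q}$. Writing $-C=\{p-k : k\in C\}$, one has $T^{(b)}_{-C}=-T^{(b)}_C$, and one class is selected from each pair $C,-C$ by the following choice: let $g$ be a primitive root modulo $p$, let $n=q/2$, and for $j=1,\ldots,n$ let $C_j\in G/H$ be the class of $g^{2(j-1)}$. Put $T^{(b)}_j=T^{(b)}_{C_j}$. The vector $T^{(b)}=(T^{(b)}_1,\ldots,T^{(b)}_n)$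 is called the $b$-deviation vector of $G/H$. $X$ is the group of characters of $G/H$, whose elements are regarded as Dirichlet characters modulo $p$ that are trivial on $H$, and $X^-=\{\chi\in X:\chi(-1)=-1\}$ is the set of odd characters in $X$. Each $\chi\in X^-$ is identified with the vector $(\chi(C_1),\ldots,\chi(C_n))\in\mathbb{C}^n$, and $\langle z,u\rangle=\sum_{j=1}^n z_j\overline{u_j}$ is the standard scalar product on $\mathbb{C}^n$. For $\chi\in X^-$, $B_\chi=\frac1p\sum_{k=1}^{p-1}\chi(k)k$ is the corresponding Bernoulli number.
   Formalization: The choice of C_j as the class of g^{2(j-1)} is covered only for odd n; for even n it does not pick one class from each pair C, -C and the formula fails (p=5, q=4, b=2). The formula is instead proved for every selection of one class from each pair, for all n. *)

theory Defs
  imports Complex_Main "HOL-Number_Theory.Number_Theory"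
begin

text \<open>
  The group \<open>(\<int>/p\<int>)\<^sup>\<times>\<close> for a prime \<open>p\<close>. Its carrier consists of the integers
  \<open>1, \<dots>, p - 1\<close>, so that a coset of a subgroup is literally a set of such integers.
\<close>
definition unit_grp :: "nat \<Rightarrow> int monoid" where
  "unit_grp p = units_of (residue_ring (int p))"

definition power_subgrp :: "nat \<Rightarrow> nat \<Rightarrow> int set" where
  "power_subgrp p q = {x [^]\<^bsub>unit_grp p\<^esub> q | x. x \<in> carrier (unit_grp p)}"

definition quot_grp :: "nat \<Rightarrow> nat \<Rightarrow> int set monoid" where
  "quot_grp p q = unit_grp p Mod power_subgrp p q"

text \<open>Only meaningful for integers \<open>k\<close> that are not divisible by \<open>p\<close>.\<close>
definition residue_cls :: "nat \<Rightarrow> nat \<Rightarrow> int \<Rightarrow> int set" where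
  "residue_cls p q k = power_subgrp p q #>\<^bsub>unit_grp p\<^esub> (k mod int p)"

definition neg_cls :: "nat \<Rightarrow> int set \<Rightarrow> int set" where
  "neg_cls p D = (\<lambda>k. int p - k) ` D"

definition theta :: "nat \<Rightarrow> nat \<Rightarrow> int \<Rightarrow> real" where
  "theta p b k = real_of_int (int b * (k mod int p) - (int b * k) mod int p) / real p"

definition S_cls :: "nat \<Rightarrow> nat \<Rightarrow> int set \<Rightarrow> real" where
  "S_cls p b D = (\<Sum>k\<in>D. theta p b k)"

definition E_mean :: "nat \<Rightarrow> nat \<Rightarrow> nat \<Rightarrow> real" where
  "E_mean p q b = (real b - 1) * (real p - 1) / (2 * real q)"

definition T_cls :: "nat \<Rightarrow> nat \<Rightarrow> nat \<Rightarrow> int set \<Rightarrow> real" where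
  "T_cls p q b D = S_cls p b D - E_mean p q b"

text \<open>The classes \<open>C 1, \<dots>, C n\<close> contain exactly one member of each pair \<open>D, -D\<close>.\<close>
definition selects_one_of_each_pair ::
    "nat \<Rightarrow> nat \<Rightarrow> nat \<Rightarrow> (nat \<Rightarrow> int set) \<Rightarrow> bool" where
  "selects_one_of_each_pair p q n C \<longleftrightarrow>
     (\<forall>j\<in>{1..n}. C j \<in> carrier (quot_grp p q)) \<and>
     (\<forall>D\<in>carrier (quot_grp p q). \<exists>!j. j \<in> {1..n} \<and> (C j = D \<or> C j = neg_cls p D))"

text \<open>
  For \<open>q = 2 n\<close> and \<open>-1\<close> not a \<open>q\<close>-th power, these classes for \<open>j = 1, \<dots>, n\<close> meet each pair
  \<open>D, -D\<close> exactly once if and only if \<open>n\<close> is odd: \<open>-1\<close> lies in the class of \<open>g ^ n\<close>, so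
  for even \<open>n\<close> the class with \<open>j = 1 + n div 2\<close> is the negative of the one with \<open>j = 1\<close>.
\<close>
definition primroot_cls :: "nat \<Rightarrow> nat \<Rightarrow> nat \<Rightarrow> nat \<Rightarrow> int set" where
  "primroot_cls p q g j = residue_cls p q (int g ^ (2 * (j - 1)))"

text \<open>Vectors in \<open>\<complex>\<^sup>n\<close> are functions on \<open>{1..n}\<close>; values outside this range are irrelevant.\<close>
definition scalar_prod :: "nat \<Rightarrow> (nat \<Rightarrow> complex) \<Rightarrow> (nat \<Rightarrow> complex) \<Rightarrow> complex" where
  "scalar_prod n z u = (\<Sum>j=1..n. z j * cnj (u j))"

definition deviation_vec ::
    "nat \<Rightarrow> nat \<Rightarrow> nat \<Rightarrow> (nat \<Rightarrow> int set) \<Rightarrow> nat \<Rightarrow> complex" where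
  "deviation_vec p q b C j = complex_of_real (T_cls p q b (C j))"

definition complex_units :: "complex monoid" where
  "complex_units = \<lparr>carrier = UNIV - {0}, monoid.mult = (*), one = 1\<rparr>"

definition quot_characters :: "nat \<Rightarrow> nat \<Rightarrow> (int set \<Rightarrow> complex) set" where
  "quot_characters p q = hom (quot_grp p q) complex_units"

text \<open>A character of the quotient, regarded as a Dirichlet character modulo \<open>p\<close>.\<close>
definition dirichlet_of ::
    "nat \<Rightarrow> nat \<Rightarrow> (int set \<Rightarrow> complex) \<Rightarrow> int \<Rightarrow> complex" where
  "dirichlet_of p q \<chi> k = (if int p dvd k then 0 else \<chi> (residue_cls p q k))"

definition odd_characters :: "nat \<Rightarrow> nat \<Rightarrow> (int set \<Rightarrow> complex) set" where
  "odd_characters p q = {\<chi> \<in> quot_characters p q. dirichlet_of p q \<chi> (-1) = -1}"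

definition char_vec :: "(nat \<Rightarrow> int set) \<Rightarrow> (int set \<Rightarrow> complex) \<Rightarrow> nat \<Rightarrow> complex" where
  "char_vec C \<chi> j = \<chi> (C j)"

definition conj_char :: "(int set \<Rightarrow> complex) \<Rightarrow> int set \<Rightarrow> complex" where
  "conj_char \<chi> D = cnj (\<chi> D)"

definition bernoulli_char :: "nat \<Rightarrow> nat \<Rightarrow> (int set \<Rightarrow> complex) \<Rightarrow> complex" where
  "bernoulli_char p q \<chi> =
     1 / of_nat p * (\<Sum>k=1..int p - 1. dirichlet_of p q \<chi> k * of_int k)"

end

theory Submission
  imports Defs
begin

text \<open>
  Both \<open>T\<close> and an odd character change sign under \<open>D \<mapsto> -D\<close> (for \<open>T\<close> because all classes have
  \<open>(p - 1) / q\<close> elements), so twice the scalar product is the sum of \<open>\<chi>\<^sup>- T\<close> over all classes, where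
  \<open>\<chi>\<^sup>-\<close> is the conjugate character. The mean value \<open>E\<close> drops out of this sum, which leaves
  \<open>\<Sum>\<^sub>k \<chi>\<^sup>-(k) \<theta>\<^sub>b(k)\<close>; substituting \<open>k \<mapsto> b k\<close> in the part with \<open>(b k)\<^sub>p\<close> produces the factor
  \<open>b - \<chi>(b)\<close>. For the selection by a primitive root, \<open>-1\<close> lies in the class of \<open>g\<^sup>n\<close>, so for odd
  \<open>n\<close> negation exchanges the classes of even and odd powers of \<open>g\<close>.
\<close>

section \<open>The unit group modulo p, its classes and their negatives\<close>

locale power_residue_classes =
  fixes p q :: nat
  assumes prime_p: "prime p" and q_dvd: "q dvd p - 1"
begin

abbreviation "G \<equiv> unit_grp p"
abbreviation "H \<equiv> power_subgrp p q"
abbreviation "Q \<equiv> carrier (quot_grp p q)"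
abbreviation "cls \<equiv> residue_cls p q"
abbreviation "neg \<equiv> neg_cls p"

lemma p_gt_1: "p > 1"
  using prime_p prime_gt_1_nat by blast

lemma q_pos: "q > 0"
  using q_dvd p_gt_1 by (auto intro: Nat.gr0I)

sublocale residues_prime p "residue_ring (int p)"
  by unfold_locales (use prime_p in auto)

lemma prime_int_p: "prime (int p)"
  using prime_p by simp

lemma carrier_unit_grp: "carrier G = {1..int p - 1}"
  using p_gt_1 res_prime_units_eq by (simp add: unit_grp_def units_of_carrier of_nat_diff)

lemma mult_unit_grp: "x \<otimes>\<^bsub>G\<^esub> y = x * y mod int p"
  by (simp add: unit_grp_def units_of_mult res_mult_eq)

lemma one_unit_grp: "\<one>\<^bsub>G\<^esub> = 1"
  by (simp add: unit_grp_def units_of_one res_one_eq)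

lemma mod_in_unit_grp: "k mod int p \<in> carrier G \<longleftrightarrow> \<not> int p dvd k"
proof -
  have "0 \<le> k mod int p" "k mod int p < int p"
    using p_gt_1 by auto
  then show ?thesis
    by (auto simp: carrier_unit_grp dvd_eq_mod_eq_0)
qed

lemma unit_grp_mod: "x \<in> carrier G \<Longrightarrow> x mod int p = x"
  by (simp add: carrier_unit_grp)

lemma unit_grp_not_dvd: "x \<in> carrier G \<Longrightarrow> \<not> int p dvd x"
  using mod_in_unit_grp unit_grp_mod by metis

lemma comm_group_unit_grp: "comm_group G"
  unfolding unit_grp_def by (rule units_comm_group)

sublocale units: comm_group G
  by (rule comm_group_unit_grp)

lemma pow_unit_grp: "x \<in> carrier G \<Longrightarrow> x [^]\<^bsub>G\<^esub> (i::nat) = x ^ i mod int p"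
proof (induction i)
  case 0
  then show ?case using p_gt_1 by (simp add: one_unit_grp)
next
  case (Suc i)
  then show ?case by (simp add: mult_unit_grp mod_mult_right_eq mult.commute)
qed

lemma subgroup_H: "subgroup H G"
proof
  show "H \<subseteq> carrier G"
    by (auto simp: power_subgrp_def)
  show "\<one>\<^bsub>G\<^esub> \<in> H"
    unfolding power_subgrp_def by (smt (verit) mem_Collect_eq units.nat_pow_one units.one_closed)
next
  fix x y assume "x \<in> H" "y \<in> H"
  then show "x \<otimes>\<^bsub>G\<^esub> y \<in> H"
    unfolding power_subgrp_def
    by (smt (verit) mem_Collect_eq units.pow_mult_distrib units.m_comm units.m_closed)
next
  fix x assume "x \<in> H"
  then show "inv\<^bsub>G\<^esub> x \<in> H"
    unfolding power_subgrp_def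
    by (smt (verit) mem_Collect_eq units.nat_pow_inv units.inv_closed)
qed

sublocale H: normal H G
  using units.subgroup_imp_normal[OF subgroup_H] .

lemma Q_eq_rcosets: "Q = rcosets\<^bsub>G\<^esub> H"
  by (simp add: quot_grp_def FactGroup_def)

lemma finite_carrier: "finite (carrier G)"
  by (simp add: carrier_unit_grp)

lemma Q_eq_cls: "Q = cls ` carrier G"
  unfolding quot_grp_def carrier_FactGroup residue_cls_def
  by (intro image_cong) (simp_all add: unit_grp_mod)

lemma cls_mod: "cls (k mod int p) = cls k"
  by (simp add: residue_cls_def)

lemma cls_in_Q: "\<not> int p dvd k \<Longrightarrow> cls k \<in> Q"
  using mod_in_unit_grp cls_mod Q_eq_cls by (metis imageI)

lemma Q_cases:
  assumes "D \<in> Q" obtains k where "k \<in> carrier G" "\<not> int p dvd k" "D = cls k"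
  using assms unit_grp_not_dvd by (auto simp: Q_eq_cls)

lemma cls_mult:
  assumes "\<not> int p dvd k" "\<not> int p dvd l"
  shows "cls (k * l) = cls k <#>\<^bsub>G\<^esub> cls l"
  using assms H.rcos_sum[of "k mod int p" "l mod int p"]
  by (simp add: mod_in_unit_grp residue_cls_def mult_unit_grp mod_mult_eq)

text \<open>Distinct cosets are disjoint, so every element of a class represents it. The condition
  \<open>x \<in> carrier G\<close> is there because \<open>cls\<close> reduces its argument modulo p
  first, whereas a class contains only reduced residues.\<close>

lemma mem_cls_iff:
  assumes "\<not> int p dvd k"
  shows "x \<in> cls k \<longleftrightarrow> x \<in> carrier G \<and> cls x = cls k"
proof
  assume x: "x \<in> cls k"
  then have "x \<in> carrier G"
    using assms mod_in_unit_grp unfolding residue_cls_def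
    by (meson H.elemrcos_carrier units.is_group)
  moreover have "cls x = cls k"
    using units.repr_independence[of x H "k mod int p"] x assms subgroup_H
      \<open>x \<in> carrier G\<close> by (simp add: residue_cls_def mod_in_unit_grp unit_grp_mod)
  ultimately show "x \<in> carrier G \<and> cls x = cls k" by simp
next
  assume "x \<in> carrier G \<and> cls x = cls k"
  then show "x \<in> cls k"
    using units.rcos_self[OF _ subgroup_H, of x] unit_grp_mod[of x]
    by (auto simp: residue_cls_def)
qed

text \<open>Negation acts on classes as multiplication by \<open>cls (- 1)\<close>, and doing it
  twice restores the argument, so a sign can be moved across an equation.\<close>

lemma cls_minus_eq_iff:
  assumes "\<not> int p dvd k" "\<not> int p dvd l"
  shows "cls (- k) = cls l \<longleftrightarrow> cls k = cls (- l)"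
proof -
  have m1: "\<not> int p dvd - 1" using p_gt_1 by auto
  have eq: "cls (- x) = cls (- 1) <#>\<^bsub>G\<^esub> cls x" if "\<not> int p dvd x" for x
    using cls_mult[OF m1 that] by simp
  show ?thesis
    using eq[OF assms(1)] eq[OF assms(2)] eq[of "- k"] eq[of "- l"] assms by auto
qed

text \<open>Since p - k and -k are congruent, the elementwise reflection \<open>neg_cls\<close>
  agrees with negation of a representative; from here on negatives of classes are computed through
  representatives.\<close>

lemma neg_cls_cls:
  assumes k: "\<not> int p dvd k"
  shows "neg (cls k) = cls (- k)"
proof (rule Set.set_eqI)
  fix x
  have cls_diff: "cls (int p - x) = cls (- x)" for x
    using cls_mod[of "int p - x"] cls_mod[of "- x"] by simp
  have "x \<in> neg (cls k) \<longleftrightarrow> int p - x \<in> cls k"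
    by (force simp: neg_cls_def image_iff)
  also have "\<dots> \<longleftrightarrow> x \<in> carrier G \<and> cls (- x) = cls k"
    unfolding mem_cls_iff[OF k] cls_diff by (auto simp: carrier_unit_grp)
  also have "\<dots> \<longleftrightarrow> x \<in> carrier G \<and> cls x = cls (- k)"
    using cls_minus_eq_iff[of x k] unit_grp_not_dvd k by blast
  also have "\<dots> \<longleftrightarrow> x \<in> cls (- k)"
    using mem_cls_iff[of "- k"] k by simp
  finally show "x \<in> neg (cls k) \<longleftrightarrow> x \<in> cls (- k)" .
qed

lemma neg_in_Q: "D \<in> Q \<Longrightarrow> neg D \<in> Q"
  by (elim Q_cases) (simp add: neg_cls_cls cls_in_Q)

lemma neg_neg: "neg (neg D) = D"
  by (simp add: neg_cls_def image_image)

lemma cls_1: "cls 1 = H"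
  using units.coset_mult_one[of H] H.subset p_gt_1 by (simp add: residue_cls_def one_unit_grp)

text \<open>Cancelling k from \<open>cls (- k) = cls k\<close> by means of an inverse l modulo p
  would give \<open>cls (- 1) = cls 1 = H\<close>, that is, -1 in H.\<close>

lemma neg_neq:
  assumes "(- 1) mod int p \<notin> H" "D \<in> Q"
  shows "neg D \<noteq> D"
proof
  assume "neg D = D"
  from \<open>D \<in> Q\<close> obtain k where k: "k \<in> carrier G" "\<not> int p dvd k" "D = cls k"
    by (rule Q_cases)
  have m1: "\<not> int p dvd - 1" using p_gt_1 by auto
  obtain l where l: "l \<in> carrier G" "l \<otimes>\<^bsub>G\<^esub> k = \<one>\<^bsub>G\<^esub>"
    using k units.l_inv_ex by blast
  have lk: "cls (l * x * k) = cls x" for x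
  proof -
    have "l * k mod int p = 1" using l by (simp add: mult_unit_grp one_unit_grp)
    then have "(l * x * k) mod int p = x mod int p"
      by (metis mod_mult_right_eq mult.assoc mult.commute mult.right_neutral)
    then show ?thesis by (metis cls_mod)
  qed
  have "cls (- k) = cls k"
    using \<open>neg D = D\<close> k neg_cls_cls by simp
  then have "cls (l * - k) = cls (l * k)"
    using k l unit_grp_not_dvd by (simp only: cls_mult dvd_minus_iff)
  then have "cls (- 1) = cls 1"
    using lk[of "-1"] lk[of 1] by simp
  then have "(- 1) mod int p \<in> cls 1"
    using mem_cls_iff[of 1 "(- 1) mod int p"] m1 cls_mod[of "- 1"] p_gt_1
    by (simp add: mod_in_unit_grp zdvd_not_zless)
  then show False using assms cls_1 by simp
qed

lemma Union_Q: "\<Union>Q = carrier G"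
  using units.rcosets_part_G[OF subgroup_H] by (simp add: Q_eq_rcosets)

lemma sum_Q_sum: "(\<Sum>D\<in>Q. \<Sum>k\<in>D. F k) = (\<Sum>k\<in>carrier G. F k)"
proof -
  have "(\<Sum>k\<in>\<Union>Q. F k) = (sum \<circ> sum) F Q"
  proof (rule sum.Union_disjoint)
    show "\<forall>D\<in>Q. finite D"
      using Union_Q finite_carrier by (metis Union_upper finite_subset)
    show "\<forall>A\<in>Q. \<forall>B\<in>Q. A \<noteq> B \<longrightarrow> A \<inter> B = {}"
      using units.rcos_disjoint[OF subgroup_H]
      by (auto simp: Q_eq_rcosets pairwise_def disjnt_def)
  qed
  then show ?thesis by (simp add: Union_Q)
qed

subsection \<open>Primitive roots and the size of the classes\<close>

lemma primroot_not_dvd: "residue_primroot p g \<Longrightarrow> \<not> int p dvd int g ^ i"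
  using prime_int_p p_gt_1 unfolding residue_primroot_def
  by (metis coprime_absorb_left int_dvd_int_iff nat_neq_iff nat_dvd_1_iff_1 prime_dvd_power)

lemma primroot_power_cong_iff:
  assumes "residue_primroot p g"
  shows "int g ^ i mod int p = int g ^ j mod int p \<longleftrightarrow> [i = j] (mod (p - 1))"
  using assms order_divides_expdiff[of p g i j] prime_p
  by (simp add: residue_primroot_def totient_prime cong_def flip: of_nat_power of_nat_mod)

lemma unit_grp_eq_primroot_power:
  assumes g: "residue_primroot p g" and x: "x \<in> carrier G"
  obtains i where "x = int g ^ i mod int p"
proof -
  have "nat x \<in> totatives p"
    using x prime_p by (auto simp: carrier_unit_grp totatives_prime)
  then obtain i where "nat x = g ^ i mod p"
    using residue_primroot_is_generator[OF p_gt_1 g] by (auto simp: bij_betw_def)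
  then have "int (nat x) = int g ^ i mod int p"
    by (simp add: of_nat_mod)
  then have "x = int g ^ i mod int p"
    using x by (simp add: carrier_unit_grp)
  then show ?thesis by (rule that)
qed

text \<open>As every unit is a power of g, H consists of the powers of g with exponent q s. Equality
  of the two classes thus means that i and q s + j are congruent modulo p - 1 for some s, and
  because q divides p - 1 this comes down to a congruence modulo q.\<close>

lemma cls_primroot_power_eq_iff:
  assumes g: "residue_primroot p g"
  shows "cls (int g ^ i) = cls (int g ^ j) \<longleftrightarrow> [i = j] (mod q)"
proof -
  have *: "cls (int g ^ i) = cls (int g ^ j) \<longleftrightarrow> (\<exists>s. [i = q * s + j] (mod (p - 1)))" for i j
  proof -
    have H: "H = range (\<lambda>s. int g ^ (q * s) mod int p)"
    proof (intro equalityI subsetI)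
      fix h assume "h \<in> H"
      then obtain x where x: "x \<in> carrier G" "h = x [^]\<^bsub>G\<^esub> q"
        unfolding power_subgrp_def by blast
      obtain s where "x = int g ^ s mod int p"
        by (rule unit_grp_eq_primroot_power[OF g x(1)])
      then have "h = int g ^ (q * s) mod int p"
        using x by (simp add: pow_unit_grp power_mod mult.commute[of q] flip: power_mult)
      then show "h \<in> range (\<lambda>s. int g ^ (q * s) mod int p)" by blast
    next
      fix h assume "h \<in> range (\<lambda>s. int g ^ (q * s) mod int p)"
      then obtain s where s: "h = int g ^ (q * s) mod int p" by blast
      have c: "int g ^ s mod int p \<in> carrier G"
        using primroot_not_dvd[OF g] by (simp add: mod_in_unit_grp)
      then have "h = (int g ^ s mod int p) [^]\<^bsub>G\<^esub> q"
        using s by (simp add: pow_unit_grp power_mod mult.commute[of q] flip: power_mult)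
      with c show "h \<in> H" unfolding power_subgrp_def by blast
    qed
    have "cls (int g ^ i) = cls (int g ^ j) \<longleftrightarrow> int g ^ i mod int p \<in> cls (int g ^ j)"
      using mem_cls_iff[OF primroot_not_dvd[OF g]] primroot_not_dvd[OF g]
      by (simp add: mod_in_unit_grp cls_mod)
    also have "\<dots> \<longleftrightarrow> (\<exists>s. int g ^ i mod int p = int g ^ (q * s + j) mod int p)"
      unfolding residue_cls_def r_coset_def H
      by (auto simp: mult_unit_grp mod_mult_eq power_add)
    finally show ?thesis by (simp add: primroot_power_cong_iff[OF g])
  qed
  \<comment> \<open>The witness s is a natural number, hence the assumption
    \<open>j \<le> i\<close>; the other case follows by exchanging i and j.\<close>
  have ge: "cls (int g ^ i) = cls (int g ^ j)" if ij: "[i = j] (mod q)" "j \<le> i" for i j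
  proof -
    obtain s where "i = q * s + j"
      using ij by (auto simp: cong_le_nat mult.commute)
    then have "[i = q * s + j] (mod (p - 1))" by simp
    then show ?thesis unfolding * by blast
  qed
  show ?thesis
  proof
    assume "cls (int g ^ i) = cls (int g ^ j)"
    then obtain s where "[i = q * s + j] (mod (p - 1))" unfolding * by blast
    then have "[i = q * s + j] (mod q)" by (rule cong_dvd_modulus_nat) (rule q_dvd)
    then show "[i = j] (mod q)" by (simp add: cong_def)
  next
    assume "[i = j] (mod q)"
    then show "cls (int g ^ i) = cls (int g ^ j)"
      using ge[of i j] ge[of j i] by (metis cong_sym nle_le)
  qed
qed

lemma Q_eq_primroot_powers:
  assumes g: "residue_primroot p g"
  shows "Q = (\<lambda>i. cls (int g ^ i)) ` {..<q}"
proof (intro equalityI subsetI)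
  fix D assume "D \<in> Q"
  then obtain x where x: "x \<in> carrier G" "D = cls x" by (auto simp: Q_eq_cls)
  obtain i where "x = int g ^ i mod int p" by (rule unit_grp_eq_primroot_power[OF g x(1)])
  then have "D = cls (int g ^ (i mod q))"
    using x cls_primroot_power_eq_iff[OF g, of i "i mod q"] by (simp add: cls_mod cong_def)
  then show "D \<in> (\<lambda>i. cls (int g ^ i)) ` {..<q}" using q_pos by auto
qed (use cls_in_Q primroot_not_dvd[OF g] in blast)

text \<open>The powers of a primitive root with exponents below q give exactly q classes; all cosets
  have the size of H, so Lagrange's theorem applies.\<close>

lemma card_class:
  assumes "D \<in> Q"
  shows "q * card D = p - 1"
proof -
  obtain g where g: "residue_primroot p g"
    using prime_primitive_root_exists prime_p p_gt_1 by blast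
  have "card Q = q"
    unfolding Q_eq_primroot_powers[OF g]
    by (subst card_image)
      (auto simp: inj_on_def cls_primroot_power_eq_iff[OF g] cong_less_modulus_unique_nat)
  moreover have "card H = card D"
    using assms units.card_rcosets_equal H.subset by (simp add: Q_eq_rcosets)
  ultimately show ?thesis
    using units.lagrange[OF subgroup_H] p_gt_1
    by (simp add: Q_eq_rcosets order_def carrier_unit_grp)
qed

section \<open>Sign change of the deviations and summation over pairs of classes\<close>

text \<open>As p does not divide b k, the residues of b k and b (p - k) add up to p. The two
  numerators therefore add up to b p - p.\<close>

lemma theta_neg:
  assumes "k \<in> carrier G" "\<not> p dvd b"
  shows "theta p b k + theta p b (int p - k) = real b - 1"
proof -
  have "\<not> int p dvd int b * k"
    using assms unit_grp_not_dvd prime_int_p by (auto simp: prime_dvd_mult_iff)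
  then have "(- (int b * k)) mod int p = int p - (int b * k) mod int p"
    by (simp add: dvd_eq_mod_eq_0 zmod_zminus1_eq_if)
  moreover have "(int b * (int p - k)) mod int p = (- (int b * k)) mod int p"
    using mod_mult_self2[of "- (int b * k)" "int p" "int b"] by (simp add: algebra_simps)
  ultimately have "(int b * (int p - k)) mod int p = int p - (int b * k) mod int p" by simp
  moreover have "int p - k \<in> carrier G"
    using assms by (auto simp: carrier_unit_grp)
  then have "k mod int p = k" "(int p - k) mod int p = int p - k"
    using assms unit_grp_mod by blast+
  ultimately have "theta p b k + theta p b (int p - k)
      = (real b * k - (int b * k) mod int p + (real b * (real p - k) - (real p - (int b * k) mod int p))) / real p"
    unfolding theta_def by (simp flip: add_divide_distrib)
  also have "\<dots> = (real b - 1) * real p / real p" by (simp add: algebra_simps)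
  finally show ?thesis using p_gt_1 by simp
qed

text \<open>Summing \<open>theta_neg\<close> over D gives \<open>card D * (b - 1)\<close>, which by
  \<open>card_class\<close> is (p - 1)(b - 1)/q, twice the mean \<open>E_mean\<close>. So the sums
  over D and its negative lie symmetrically about the mean.\<close>

lemma T_cls_neg:
  assumes "D \<in> Q" "\<not> p dvd b"
  shows "T_cls p q b (neg D) = - T_cls p q b D"
proof -
  have D: "D \<subseteq> carrier G" using assms Union_Q by blast
  have "S_cls p b D + S_cls p b (neg D) = (\<Sum>k\<in>D. theta p b k + theta p b (int p - k))"
    unfolding S_cls_def neg_cls_def by (subst sum.reindex) (auto simp: inj_on_def sum.distrib)
  also have "\<dots> = (\<Sum>k\<in>D. real b - 1)"
    using D theta_neg assms by (intro sum.cong) auto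
  finally have "S_cls p b D + S_cls p b (neg D) = real (card D) * (real b - 1)" by simp
  moreover have "real q * real (card D) = real p - 1"
    using card_class[OF assms(1)] p_gt_1 by (metis of_nat_1 of_nat_diff of_nat_mult less_imp_le_nat)
  ultimately have "real q * (S_cls p b D + S_cls p b (neg D)) = (real p - 1) * (real b - 1)"
    by (metis mult.assoc)
  then have "S_cls p b D + S_cls p b (neg D) = 2 * E_mean p q b"
    using q_pos unfolding E_mean_def by (simp add: field_simps)
  then show ?thesis by (simp add: T_cls_def)
qed

text \<open>The classes C j and their negatives together exhaust the quotient. No class is counted
  twice: the selection is unique, and -1 outside H keeps a class from being its own
  negative.\<close>

lemma sum_Q_eq_sum_pairs:
  assumes sel: "selects_one_of_each_pair p q n C" and m1: "(- 1) mod int p \<notin> H"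
  shows "(\<Sum>D\<in>Q. F D) = (\<Sum>j=1..n. F (C j) + F (neg (C j)))"
proof -
  have CQ: "C j \<in> Q" if "j \<in> {1..n}" for j
    using sel that by (auto simp: selects_one_of_each_pair_def)
  \<comment> \<open>Both i and j are indices selected for the pair of D = C j, and such an index is
    unique.\<close>
  have uniq: "i = j" if "i \<in> {1..n}" "j \<in> {1..n}" "C i = C j \<or> C i = neg (C j)" for i j
    using sel that CQ[of j] unfolding selects_one_of_each_pair_def by blast
  have inj: "inj_on C {1..n}" "inj_on (\<lambda>j. neg (C j)) {1..n}"
    using uniq neg_neg unfolding inj_on_def by metis+
  have Q: "Q = C ` {1..n} \<union> (\<lambda>j. neg (C j)) ` {1..n}"
  proof (intro equalityI subsetI)
    fix D assume "D \<in> Q"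
    then obtain j where "j \<in> {1..n}" "C j = D \<or> C j = neg D"
      using sel unfolding selects_one_of_each_pair_def by blast
    then show "D \<in> C ` {1..n} \<union> (\<lambda>j. neg (C j)) ` {1..n}"
      using neg_neg[of D] by (metis UnI1 UnI2 image_eqI)
  qed (use CQ neg_in_Q in blast)
  have "C ` {1..n} \<inter> (\<lambda>j. neg (C j)) ` {1..n} = {}"
  proof (intro equals0I)
    fix D assume "D \<in> C ` {1..n} \<inter> (\<lambda>j. neg (C j)) ` {1..n}"
    then obtain i j where ij: "i \<in> {1..n}" "j \<in> {1..n}" "C i = neg (C j)" by auto
    then have "i = j" using uniq by blast
    then show False using ij neg_neq[OF m1 CQ[OF ij(1)]] by simp
  qed
  then show ?thesis
    unfolding Q using inj by (simp add: sum.union_disjoint sum.reindex sum.distrib)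
qed

subsection \<open>Characters\<close>

context
  fixes \<chi> :: "int set \<Rightarrow> complex"
  assumes char: "\<chi> \<in> quot_characters p q"
begin

abbreviation "f \<equiv> dirichlet_of p q \<chi>"

lemma dirichlet_neq_0: "\<not> int p dvd k \<Longrightarrow> f k \<noteq> 0"
  using char cls_in_Q by (auto simp: dirichlet_of_def quot_characters_def hom_def complex_units_def)

lemma dirichlet_mod: "f (k mod int p) = f k"
  by (simp add: dirichlet_of_def cls_mod dvd_mod_iff)

text \<open>The extension by 0 stays multiplicative because p is prime: p divides k l only if it
  divides a factor, and then both sides vanish.\<close>

lemma dirichlet_mult: "f (k * l) = f k * f l"
  using char cls_mult cls_in_Q prime_int_p
  by (auto simp: dirichlet_of_def quot_characters_def hom_def complex_units_def quot_grp_def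
      prime_dvd_mult_iff)

text \<open>The value at 1 is idempotent and nonzero.\<close>

lemma dirichlet_1: "f 1 = 1"
  using dirichlet_mult[of 1 1] dirichlet_neq_0[of 1] p_gt_1 by simp

lemma dirichlet_power: "f (k ^ i) = f k ^ i"
  by (induction i) (simp_all add: dirichlet_1 dirichlet_mult)

text \<open>Fermat's little theorem makes the value a (p - 1)-th root of unity. This is what allows
  complex conjugates to serve as inverses.\<close>

lemma norm_dirichlet:
  assumes "\<not> int p dvd k"
  shows "norm (f k) = 1"
proof -
  have "k mod int p \<in> carrier G" using assms mod_in_unit_grp by blast
  then have "(k mod int p) [^]\<^bsub>G\<^esub> order G = \<one>\<^bsub>G\<^esub>"
    by (rule units.pow_order_eq_1)
  then have "(k mod int p) ^ (p - 1) mod int p = 1"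
    using \<open>k mod int p \<in> carrier G\<close> p_gt_1
    by (simp add: pow_unit_grp one_unit_grp order_def carrier_unit_grp nat_diff_distrib)
  then have "f k ^ (p - 1) = 1"
    by (metis dirichlet_mod dirichlet_power dirichlet_1)
  then show ?thesis
    using p_gt_1 by (metis norm_one norm_power norm_ge_zero power_eq_imp_eq_base power_one
        zero_le_one zero_less_diff)
qed

lemma dirichlet_mult_cnj: "\<not> int p dvd k \<Longrightarrow> f k * cnj (f k) = 1"
  using norm_dirichlet by (simp add: complex_norm_square[symmetric])

lemma sum_cnj_dirichlet_theta:
  assumes b: "\<not> p dvd b"
  shows "(\<Sum>k\<in>carrier G. cnj (f k) * of_real (theta p b k))
    = (of_nat b - f (int b)) * bernoulli_char p q (conj_char \<chi>)"
proof -
  \<comment> \<open>\<open>B\<close> is p times the Bernoulli number of the conjugate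
    character.\<close>
  define B where "B = (\<Sum>k\<in>carrier G. cnj (f k) * of_int k)"
  have bint: "\<not> int p dvd int b" using b by simp
  let ?m = "\<lambda>k. int b * k mod int p"
  \<comment> \<open>Multiplication by b permutes the units: it is injective by cancellation, hence
    onto by finiteness.\<close>
  have "inj_on ?m (carrier G)"
    using units.inj_on_cmult[of "int b mod int p"] bint
    by (simp add: mult_unit_grp mod_in_unit_grp mod_mult_left_eq cong: inj_on_cong)
  moreover have "?m ` carrier G \<subseteq> carrier G"
    using bint prime_int_p unit_grp_not_dvd by (auto simp: mod_in_unit_grp prime_dvd_mult_iff)
  ultimately have "bij_betw ?m (carrier G) (carrier G)"
    unfolding bij_betw_def using endo_inj_surj[OF finite_carrier] by blast
  then have "B = (\<Sum>k\<in>carrier G. cnj (f (?m k)) * of_int (?m k))"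
    unfolding B_def by (rule sum.reindex_bij_betw[symmetric])
  \<comment> \<open>The substitution brings out the factor \<open>cnj (f b)\<close>, and multiplying
    by \<open>f b\<close> removes it because the value at b has modulus 1.\<close>
  then have "f (int b) * B = (\<Sum>k\<in>carrier G. (f (int b) * cnj (f (int b))) * cnj (f k) * of_int (?m k))"
    by (simp add: dirichlet_mod dirichlet_mult sum_distrib_left mult.assoc)
  then have fB: "f (int b) * B = (\<Sum>k\<in>carrier G. cnj (f k) * of_int (?m k))"
    using dirichlet_mult_cnj[OF bint] by simp
  have "(\<Sum>k\<in>carrier G. cnj (f k) * of_real (theta p b k))
    = (\<Sum>k\<in>carrier G. (of_nat b * (cnj (f k) * of_int k) - cnj (f k) * of_int (?m k)) / of_nat p)"
    using unit_grp_mod by (intro sum.cong) (simp_all add: theta_def field_simps)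
  also have "\<dots> = (of_nat b * B - f (int b) * B) / of_nat p"
    unfolding fB by (simp add: B_def sum_subtractf sum_distrib_left flip: sum_divide_distrib)
  also have "B = (\<Sum>k=1..int p - 1. dirichlet_of p q (conj_char \<chi>) k * of_int k)"
    unfolding B_def carrier_unit_grp
    by (intro sum.cong) (simp_all add: dirichlet_of_def conj_char_def)
  finally show ?thesis
    by (simp add: bernoulli_char_def field_simps)
qed

lemma odd_character_neg:
  assumes "f (- 1) = - 1" "D \<in> Q"
  shows "\<chi> (neg D) = - \<chi> D"
proof -
  obtain k where k: "\<not> int p dvd k" "D = cls k" using assms(2) by (rule Q_cases)
  have "f (- k) = - f k" using dirichlet_mult[of "- 1" k] assms by simp
  then show ?thesis using k by (simp add: neg_cls_cls dirichlet_of_def)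
qed

lemma scalar_prod_deviation_vec:
  assumes sel: "selects_one_of_each_pair p q n C" and m1: "(- 1) mod int p \<notin> H"
    and b: "\<not> p dvd b" and odd: "f (- 1) = - 1"
  shows "scalar_prod n (deviation_vec p q b C) (char_vec C \<chi>)
    = (of_nat b - f (int b)) * bernoulli_char p q (conj_char \<chi>) / 2"
proof -
  let ?E = "complex_of_real (E_mean p q b)"
  have CQ: "C j \<in> Q" if "j \<in> {1..n}" for j
    using sel that by (auto simp: selects_one_of_each_pair_def)
  have neg_C: "\<chi> (neg (C j)) = - \<chi> (C j)" if "j \<in> {1..n}" for j
    using odd_character_neg odd CQ that by blast
  \<comment> \<open>The two sign changes cancel in the product, so D and its negative contribute
    equally; this is the factor 2.\<close>
  have "(\<Sum>D\<in>Q. cnj (\<chi> D) * of_real (T_cls p q b D))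
      = 2 * scalar_prod n (deviation_vec p q b C) (char_vec C \<chi>)"
    unfolding sum_Q_eq_sum_pairs[OF sel m1] scalar_prod_def sum_distrib_left
    by (intro sum.cong)
      (simp_all add: neg_C T_cls_neg CQ b deviation_vec_def char_vec_def)
  \<comment> \<open>Here only one factor changes sign, so each pair cancels; this removes the term
    with the mean.\<close>
  moreover have "(\<Sum>D\<in>Q. cnj (\<chi> D)) = 0"
    unfolding sum_Q_eq_sum_pairs[OF sel m1] by (intro sum.neutral) (simp add: neg_C)
  moreover have "(\<Sum>D\<in>Q. cnj (\<chi> D) * of_real (T_cls p q b D))
      = (\<Sum>D\<in>Q. \<Sum>k\<in>D. cnj (f k) * of_real (theta p b k)) - (\<Sum>D\<in>Q. cnj (\<chi> D)) * ?E"
  proof -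
    \<comment> \<open>The character is constant on a class, so its value can be moved inside the sum
      over the elements of D.\<close>
    have "\<chi> D = f k" if "D \<in> Q" "k \<in> D" for D k
      using that mem_cls_iff by (elim Q_cases) (auto simp: dirichlet_of_def unit_grp_not_dvd)
    then have "cnj (\<chi> D) * of_real (T_cls p q b D)
        = (\<Sum>k\<in>D. cnj (f k) * of_real (theta p b k)) - cnj (\<chi> D) * ?E" if "D \<in> Q" for D
      using that by (simp add: T_cls_def S_cls_def right_diff_distrib sum_distrib_left)
    then show ?thesis by (simp add: sum_subtractf sum_distrib_right)
  qed
  ultimately show ?thesis
    by (simp add: sum_Q_sum sum_cnj_dirichlet_theta[OF b])
qed

end

subsection \<open>The classes of even powers of a primitive root\<close>

text \<open>Write -1 as g^e modulo p. The square of -1 is 1, so q = 2 n divides 2 e and n divides e;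
  -1 is not in H, so q does not divide e. Hence e is an odd multiple of n, and e is congruent to n
  modulo q.\<close>

lemma neg_cls_primroot_power:
  assumes g: "residue_primroot p g" and q: "q = 2 * n" and m1: "(- 1) mod int p \<notin> H"
  shows "neg (cls (int g ^ i)) = cls (int g ^ (i + n))"
proof -
  have nd: "\<not> int p dvd - 1" using p_gt_1 by auto
  then obtain e where e: "(- 1) mod int p = int g ^ e mod int p"
    using unit_grp_eq_primroot_power[OF g] mod_in_unit_grp by metis
  have cong_neg: "cls (- (int g ^ j)) = cls (int g ^ (j + e))" for j
  proof -
    have "(- (int g ^ j)) mod int p = int g ^ (j + e) mod int p"
      using mod_mult_cong[OF e refl, of "int g ^ j"] by (simp add: power_add mult.commute)
    then show ?thesis by (metis cls_mod)
  qed
  have "cls (int g ^ (0 + e + e)) = cls (int g ^ 0)"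
    using cong_neg[of 0] cong_neg[of "0 + e"] cls_minus_eq_iff[of 1 "int g ^ e"] primroot_not_dvd[OF g]
      primroot_not_dvd[OF g, of 0] by simp
  then have "[2 * e = 0] (mod (2 * n))"
    unfolding cls_primroot_power_eq_iff[OF g] by (simp add: q mult_2)
  then have "n dvd e" by (simp add: cong_0_iff)
  moreover have "\<not> q dvd e"
  proof
    assume "q dvd e"
    then have "cls (int g ^ e) = cls (int g ^ 0)"
      unfolding cls_primroot_power_eq_iff[OF g] by (simp add: cong_0_iff)
    then have "neg H = H"
      using cong_neg[of 0] neg_cls_cls[of 1] primroot_not_dvd[OF g, of 0] by (simp add: cls_1)
    then show False
      using neg_neq[OF m1] cls_in_Q[of 1] primroot_not_dvd[OF g, of 0] by (simp add: cls_1)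
  qed
  ultimately obtain t where t: "e = n * t" "odd t"
    using q by (elim dvdE) (auto simp: mult.commute)
  \<comment> \<open>With t = 2 s + 1, the product n t is n + 2 n s.\<close>
  then obtain s where "e = n + q * s"
    by (elim oddE) (auto simp: q algebra_simps)
  then have "[i + e = i + n] (mod q)" by (simp add: cong_def flip: add.assoc)
  then show ?thesis
    using cong_neg neg_cls_cls primroot_not_dvd[OF g] cls_primroot_power_eq_iff[OF g] by metis
qed

text \<open>The exponents 2 (j - 1) for j from 1 to n represent each even residue modulo q exactly
  once. The pair of the class of g^d has the exponents d and d + n, and for odd n exactly one of
  these is even.\<close>

lemma primroot_cls_selects:
  assumes g: "residue_primroot p g" and q: "q = 2 * n" and m1: "(- 1) mod int p \<notin> H"
    and n: "odd n"
  shows "selects_one_of_each_pair p q n (primroot_cls p q g)"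
  unfolding selects_one_of_each_pair_def
proof (intro conjI ballI)
  show "primroot_cls p q g j \<in> Q" for j
    unfolding primroot_cls_def using cls_in_Q primroot_not_dvd[OF g] by blast
next
  \<comment> \<open>Parity is well defined modulo q because q is even.\<close>
  have even_cong: "even i \<longleftrightarrow> even j" if "[i = j] (mod q)" for i j
    using that q by (metis cong_dvd_iff cong_dvd_modulus_nat dvd_triv_left)
  have key: "\<exists>!j. j \<in> {1..n} \<and> [2 * (j - 1) = d] (mod q)" if d: "even d" for d
  proof -
    obtain c where c: "d = 2 * c" using d by blast
    \<comment> \<open>Halving the congruence turns the modulus 2 n into n, so j - 1 is the remainder
      of c; the added 1 comes from indices starting at 1.\<close>
    have "[2 * (j - 1) = d] (mod q) \<longleftrightarrow> j = c mod n + 1" if "j \<in> {1..n}" for j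
      using that unfolding q c cong_def by (auto simp: mod_mult_mult1)
    moreover have "c mod n + 1 \<in> {1..n}" using q q_pos by (simp add: Suc_le_eq)
    ultimately show ?thesis by blast
  qed
  fix D assume "D \<in> Q"
  then obtain d where D: "D = cls (int g ^ d)"
    unfolding Q_eq_primroot_powers[OF g] by blast
  have iff: "primroot_cls p q g j = D \<or> primroot_cls p q g j = neg D
      \<longleftrightarrow> [2 * (j - 1) = d] (mod q) \<or> [2 * (j - 1) = d + n] (mod q)" for j
    unfolding D neg_cls_primroot_power[OF g q m1] primroot_cls_def cls_primroot_power_eq_iff[OF g] ..
  show "\<exists>!j. j \<in> {1..n} \<and> (primroot_cls p q g j = D \<or> primroot_cls p q g j = neg D)"
  proof (cases "even d")
    case True
    then have "\<not> [2 * (j - 1) = d + n] (mod q)" for j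
      using even_cong[of "2 * (j - 1)" "d + n"] n by auto
    then show ?thesis using key[OF True] unfolding iff by simp
  next
    case False
    then have "\<not> [2 * (j - 1) = d] (mod q)" for j
      using even_cong[of "2 * (j - 1)" d] by auto
    then show ?thesis using key[of "d + n"] False n unfolding iff by simp
  qed
qed

end

text \<open>Replacing a selected class by its negative changes no summand of the scalar product, so
  the formula is stated for every selection of one class from each pair. For odd n the classes of
  the even powers of g are such a selection.\<close>

theorem theorem1:
  fixes p q n b g :: nat and \<chi> :: "int set \<Rightarrow> complex"
  assumes "prime p"
    and "q = 2 * n"
    and "q dvd p - 1"
    and "(-1) mod int p \<notin> power_subgrp p q"
    and "b \<ge> 2"
    and "\<not> p dvd b"
    and "residue_primroot p g"
    and "\<chi> \<in> odd_characters p q"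
  shows "(\<forall>C. selects_one_of_each_pair p q n C \<longrightarrow>
            scalar_prod n (deviation_vec p q b C) (char_vec C \<chi>)
              = (of_nat b - dirichlet_of p q \<chi> (int b))
                  * bernoulli_char p q (conj_char \<chi>) / 2)
       \<and> (odd n \<longrightarrow>
            selects_one_of_each_pair p q n (primroot_cls p q g) \<and>
            scalar_prod n (deviation_vec p q b (primroot_cls p q g))
                (char_vec (primroot_cls p q g) \<chi>)
              = (of_nat b - dirichlet_of p q \<chi> (int b))
                  * bernoulli_char p q (conj_char \<chi>) / 2)"
proof -
  interpret power_residue_classes p q
    using assms by unfold_locales
  have \<chi>: "\<chi> \<in> quot_characters p q" "dirichlet_of p q \<chi> (- 1) = - 1"
    using assms by (auto simp: odd_characters_def)
  note formula = scalar_prod_deviation_vec[OF \<chi>(1) _ assms(4,6) \<chi>(2)]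
  show ?thesis
    by (intro conjI allI impI formula primroot_cls_selects[OF assms(7,2,4)])
qed

end
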